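(* For every fixed $n\ge 1$ there is a function $r_n:\mathbb{N}\to\mathbb{R}$ with $r_n(m)=o(m^n)$ as $m\to\infty$ such that for all $k,d\ge 1$, if $V\subset\mathbb{R}^n$ is a compact tropical prevariety given by a system of $k$ tropical polynomials in $n$ variables with finite coefficients and of maximal tropical degree $d$, then, with $m=k\binom{n+d}{n}^2$, the sum of the Betti numbers of $V$ does not exceed $$3^n+2^n\binom{m}{n}+r_n(m),$$ i.e. it does not exceed $3^n+2^n\binom{k\binom{n+d}{n}^2}{n}+o\Big(\big(k\tbinom{n+d}{n}^2\big)^n\Big)$.
   Context: A tropical polynomial $f$ in $n$ variables is given by a nonempty finite set of tropical monomials $Q_j(x)=a_j+i_{j1}x_1+\cdots+i_{jn}x_n$ with $a_j\in\mathbb{R}$ and pairwise distinct exponent vectors $(i_{j1},\dots,i_{jn})\in\mathbb{Z}_{\ge 0}^n$; $f(x)=\min_j Q_j(x)$. The tropical degree of $Q_j$ is $i_{j1}+\cdots+i_{jn}$, and the tropical degree of $f$ is the maximum of the degrees of its monomials. A tropical polynomial of tropical degree $e$ has finite coefficients if every monomial of tropical degree at most $e$ occurs in it. A point $x\in\mathbb{R}^n$ is a tropical zero of $f$ if $\min_j Q_j(x)$ is attained for at least two different $j$. The tropical prevariety given by $f_1,\dots,f_k$ is the set of all $x\in\mathbb{R}^n$ that are tropical zeros of every $f_i$. *)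

theory Defs
  imports "HOL-Analysis.Analysis" "HOL-Homology.Homology" "HOL-Library.Landau_Symbols"
begin

text \<open>
  A tropical polynomial in the variables indexed by \<open>'n\<close> is a finite nonempty partial map from
  exponent vectors to real coefficients; its domain is the set of exponent vectors of the
  monomials that occur (so these are automatically pairwise distinct), and an exponent vector
  outside the domain corresponds to the coefficient \<open>\<infinity>\<close>.
\<close>

type_synonym 'n trop_poly = "nat ^ 'n \<rightharpoonup> real"

definition tropical_polynomial :: "'n::finite trop_poly \<Rightarrow> bool" where
  "tropical_polynomial f \<longleftrightarrow> finite (dom f) \<and> dom f \<noteq> {}"

definition monomial_degree :: "nat ^ 'n::finite \<Rightarrow> nat" where
  "monomial_degree i = (\<Sum>l\<in>UNIV. i $ l)"

definition tropical_degree :: "'n::finite trop_poly \<Rightarrow> nat" where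
  "tropical_degree f = Max (monomial_degree ` dom f)"

definition finite_coefficients :: "'n::finite trop_poly \<Rightarrow> bool" where
  "finite_coefficients f \<longleftrightarrow> (\<forall>i. monomial_degree i \<le> tropical_degree f \<longrightarrow> i \<in> dom f)"

definition monomial_value :: "'n::finite trop_poly \<Rightarrow> nat ^ 'n \<Rightarrow> real ^ 'n \<Rightarrow> real" where
  "monomial_value f i x = the (f i) + (\<Sum>l\<in>UNIV. real (i $ l) * x $ l)"

definition tropical_value :: "'n::finite trop_poly \<Rightarrow> real ^ 'n \<Rightarrow> real" where
  "tropical_value f x = Min ((\<lambda>i. monomial_value f i x) ` dom f)"

definition tropical_zero :: "'n::finite trop_poly \<Rightarrow> real ^ 'n \<Rightarrow> bool" where
  "tropical_zero f x \<longleftrightarrow>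
     (\<exists>i\<in>dom f. \<exists>j\<in>dom f. i \<noteq> j \<and>
        monomial_value f i x = tropical_value f x \<and> monomial_value f j x = tropical_value f x)"

definition tropical_prevariety :: "'n::finite trop_poly list \<Rightarrow> (real ^ 'n) set" where
  "tropical_prevariety fs = {x. \<forall>f\<in>set fs. tropical_zero f x}"

text \<open>
  The rank of an abelian group (written multiplicatively, as in \<open>HOL-Algebra\<close>): the supremum of
  the sizes of its finite \<open>\<int>\<close>-linearly independent subsets.
\<close>

definition int_independent :: "('a, 'b) monoid_scheme \<Rightarrow> 'a set \<Rightarrow> bool" where
  "int_independent G S \<longleftrightarrow> finite S \<and> S \<subseteq> carrier G \<and>
     (\<forall>c::'a \<Rightarrow> int. finprod G (\<lambda>x. x [^]\<^bsub>G\<^esub> c x) S = \<one>\<^bsub>G\<^esub> \<longrightarrow> (\<forall>x\<in>S. c x = 0))"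

definition abelian_group_rank :: "('a, 'b) monoid_scheme \<Rightarrow> enat" where
  "abelian_group_rank G = (SUP S\<in>{S. int_independent G S}. enat (card S))"

text \<open>Betti numbers are ranks of the (unreduced) integral singular homology groups.\<close>

definition betti_number :: "nat \<Rightarrow> 'a topology \<Rightarrow> enat" where
  "betti_number p X = abelian_group_rank (homology_group (int p) X)"

text \<open>
  The sum is taken in \<open>ereal\<close>, so a finite upper bound on it also asserts that every Betti number
  is finite and only finitely many are nonzero.
\<close>

definition sum_betti_numbers :: "'a topology \<Rightarrow> ereal" where
  "sum_betti_numbers X = suminf (\<lambda>p. ereal_of_enat (betti_number p X))"

end

theory Submission
  imports Defs
begin

text \<open>
  On a tropical prevariety, which monomials attain the minimum is decided by the signs of the
  differences of monomials of the same polynomial. Each difference is an affine function, and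
  there are at most \<open>m = k \<cdot> C(n+d, n)\<^sup>2\<close> of them. So a prevariety \<open>V\<close> is a union of relatively open
  faces of an arrangement of at most \<open>m\<close> hyperplanes (degenerate ones allowed) in \<open>\<real>\<^sup>n\<close>.

  If \<open>V\<close> is compact, all these faces are bounded and \<open>V\<close> is a finite cell complex with the faces
  as its cells, so the sum of its Betti numbers is at most the number of faces
  (\<open>sum_betti_numbers_le_card_cells\<close>). Instead of setting up cellular homology, the faces are
  removed one by one, each before the faces in its frontier. If \<open>a\<close> is a point of the face \<open>F\<close> to be removed,
  \<open>V - {a}\<close> retracts onto \<open>V - F\<close>, and \<open>H\<^sub>p(V, V - {a})\<close> is by excision the local homology
  \<open>H\<^sub>p(F, F - {a})\<close> of a cell, which has rank one in a single degree and vanishes in all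
  others. As rank is subadditive on exact sequences (\<open>rank_exact\<close>), the sum of the Betti numbers
  drops by at most one (\<open>betti_number_le_remove_cell\<close>).

  It remains to count faces. An arrangement of \<open>m\<close> hyperplanes in dimension \<open>n\<close> has at most
  \<open>\<Sum>j\<le>n. 2\<^sup>j C(m, j)\<close> faces (\<open>card_sign_vectors_le\<close>). The top term is \<open>2\<^sup>n C(m, n)\<close>, and the
  remaining ones form the function \<open>r\<^sub>n\<close>, which is \<open>O(m\<^bsup>n-1\<^esup>)\<close>.
\<close>

section \<open>The rank of an abelian group\<close>

abbreviation lincomb :: "('a, 'b) monoid_scheme \<Rightarrow> ('j \<Rightarrow> 'a) \<Rightarrow> ('j \<Rightarrow> int) \<Rightarrow> 'j set \<Rightarrow> 'a" where
  "lincomb G x c J \<equiv> finprod G (\<lambda>j. x j [^]\<^bsub>G\<^esub> c j) J"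

text \<open>
  Independence of a family rather than of a set: two equal members make a family dependent, so
  the images of an independent set under a homomorphism can be discussed without first
  separating injectivity from independence.
\<close>

definition independent_family :: "('a, 'b) monoid_scheme \<Rightarrow> ('j \<Rightarrow> 'a) \<Rightarrow> 'j set \<Rightarrow> bool" where
  "independent_family G x J \<longleftrightarrow>
     finite J \<and> x \<in> J \<rightarrow> carrier G \<and> (\<forall>c. lincomb G x c J = \<one>\<^bsub>G\<^esub> \<longrightarrow> (\<forall>j\<in>J. c j = 0))"

context comm_group
begin

lemma lincomb_closed [simp]: "x \<in> J \<rightarrow> carrier G \<Longrightarrow> lincomb G x c J \<in> carrier G"
  by (intro finprod_closed) auto

lemma lincomb_add:
  assumes "x \<in> J \<rightarrow> carrier G"
  shows "lincomb G x (\<lambda>j. c j + d j) J = lincomb G x c J \<otimes> lincomb G x d J"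
proof -
  have "lincomb G x (\<lambda>j. c j + d j) J = finprod G (\<lambda>j. x j [^] c j \<otimes> x j [^] d j) J"
    using assms by (intro finprod_cong') (auto simp: int_pow_mult Pi_iff)
  also have "\<dots> = lincomb G x c J \<otimes> lincomb G x d J"
    using assms by (intro finprod_multf) auto
  finally show ?thesis .
qed

lemma lincomb_scale:
  assumes "finite J" "x \<in> J \<rightarrow> carrier G"
  shows "lincomb G x (\<lambda>j. d * c j) J = lincomb G x c J [^] (d::int)"
  using assms
proof (induction J rule: finite_induct)
  case empty
  then show ?case by simp
next
  case (insert j J)
  have "lincomb G x (\<lambda>j. d * c j) (insert j J) = x j [^] (d * c j) \<otimes> lincomb G x (\<lambda>j. d * c j) J"
    using insert by (intro finprod_insert) auto
  also have "\<dots> = (x j [^] c j) [^] d \<otimes> lincomb G x c J [^] d"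
    using insert by (simp add: int_pow_pow mult.commute)
  also have "\<dots> = (x j [^] c j \<otimes> lincomb G x c J) [^] d"
    using insert by (intro int_pow_distrib [symmetric]) auto
  also have "x j [^] c j \<otimes> lincomb G x c J = lincomb G x c (insert j J)"
    using insert by (intro finprod_insert [symmetric]) auto
  finally show ?case .
qed

text \<open>
  Substituting linear combinations into a linear combination multiplies the coefficient
  matrices.
\<close>

lemma lincomb_lincomb:
  assumes "finite K" "finite J" "x \<in> J \<rightarrow> carrier G"
  shows "lincomb G (\<lambda>k. lincomb G x (e k) J) d K = lincomb G x (\<lambda>j. \<Sum>k\<in>K. d k * e k j) J"
  using assms(1)
proof (induction K rule: finite_induct)
  case empty
  then show ?case by simp
next
  case (insert k K)
  have "lincomb G (\<lambda>k. lincomb G x (e k) J) d (insert k K)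
      = lincomb G x (e k) J [^] d k \<otimes> lincomb G (\<lambda>k. lincomb G x (e k) J) d K"
    using insert assms by (intro finprod_insert) auto
  also have "\<dots> = lincomb G x (\<lambda>j. d k * e k j) J \<otimes> lincomb G x (\<lambda>j. \<Sum>k\<in>K. d k * e k j) J"
    using insert assms by (simp add: lincomb_scale)
  also have "\<dots> = lincomb G x (\<lambda>j. \<Sum>k\<in>insert k K. d k * e k j) J"
    using insert assms by (subst lincomb_add [symmetric]) auto
  finally show ?case .
qed

lemma lincomb_mono_neutral:
  assumes "finite J" "x \<in> J \<rightarrow> carrier G" "I \<subseteq> J" "\<And>j. j \<in> J - I \<Longrightarrow> c j = 0"
  shows "lincomb G x c J = lincomb G x c I"
  using assms by (intro finprod_mono_neutral_cong_right) auto

lemma card_le_rank: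
  assumes "independent_family G x J"
  shows "enat (card J) \<le> abelian_group_rank G"
proof -
  have fin: "finite J" and car: "x \<in> J \<rightarrow> carrier G"
    and ind: "\<And>c. lincomb G x c J = \<one> \<Longrightarrow> \<forall>j\<in>J. c j = 0"
    using assms by (auto simp: independent_family_def)
  have inj: "inj_on x J"
  proof
    fix i j assume ij: "i \<in> J" "j \<in> J" "x i = x j"
    show "i = j"
    proof (rule ccontr)
      assume ne: "i \<noteq> j"
      \<comment> \<open>equal members would satisfy the relation x i - x j = 0\<close>
      define c where "c = (\<lambda>k. if k = i then 1 else if k = j then -1 else (0::int))"
      have "lincomb G x c J = lincomb G x c {i, j}"
        using ij by (intro lincomb_mono_neutral fin car) (auto simp: c_def)
      also have "\<dots> = x i [^] c i \<otimes> x j [^] c j"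
        using ij ne car by (subst finprod_insert) (auto simp: Pi_iff)
      also have "\<dots> = \<one>"
        using ij ne car by (auto simp: c_def int_pow_neg Pi_iff)
      finally have "c i = 0" using ind ij by blast
      then show False by (simp add: c_def)
    qed
  qed
  have "int_independent G (x ` J)"
    unfolding int_independent_def
  proof (intro conjI allI impI)
    fix c :: "'a \<Rightarrow> int" assume "finprod G (\<lambda>y. y [^] c y) (x ` J) = \<one>"
    then have "lincomb G x (c \<circ> x) J = \<one>"
      using car by (subst (asm) finprod_reindex) (auto simp: inj)
    from ind [OF this] show "\<forall>y\<in>x ` J. c y = 0" by auto
  qed (use fin car in auto)
  then have "enat (card (x ` J)) \<le> abelian_group_rank G"
    unfolding abelian_group_rank_def by (intro SUP_upper) auto
  then show ?thesis by (simp add: card_image inj)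
qed

text \<open>
  Two elements \<open>g\<^sup>m\<close> and \<open>g\<^sup>n\<close> of a cyclic group satisfy the relation with coefficients
  \<open>n\<close> and \<open>-m\<close>.
\<close>

lemma rank_cyclic_group:
  assumes "cyclic_group G"
  shows "abelian_group_rank G \<le> 1"
  unfolding abelian_group_rank_def
proof (rule SUP_least, clarify)
  fix S assume S: "int_independent G S"
  then have fin: "finite S" and car: "S \<subseteq> carrier G"
    and ind: "\<And>c. lincomb G (\<lambda>x. x) c S = \<one> \<Longrightarrow> \<forall>x\<in>S. c x = 0"
    by (auto simp: int_independent_def)
  obtain g where g: "g \<in> carrier G" "carrier G = range (\<lambda>n::int. g [^] n)"
    using assms by (auto simp: cyclic_group)
  have False if xy: "x \<in> S" "y \<in> S" "x \<noteq> y" for x y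
  proof -
    obtain m n :: int where mn: "x = g [^] m" "y = g [^] n"
      using xy car g(2) by blast
    have relation: "\<forall>z\<in>S. c z = 0" if "m * c x + n * c y = 0" "\<And>z. z \<noteq> x \<Longrightarrow> z \<noteq> y \<Longrightarrow> c z = 0" for c
    proof (rule ind)
      have "lincomb G (\<lambda>x. x) c S = lincomb G (\<lambda>x. x) c {x, y}"
        using xy car that by (intro lincomb_mono_neutral fin) auto
      also have "\<dots> = x [^] c x \<otimes> y [^] c y"
        using xy car by (subst finprod_insert) (auto simp: Pi_iff)
      also have "\<dots> = g [^] (m * c x + n * c y)"
        using g by (simp add: mn int_pow_pow int_pow_mult)
      finally show "lincomb G (\<lambda>x. x) c S = \<one>" using that by simp
    qed
    have "m = 0" "n = 0"
      using relation [of "\<lambda>z. if z = x then n else if z = y then -m else 0"] xy by auto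
    then have "x = y" by (simp add: mn)
    then show False using xy by simp
  qed
  then have "card S \<le> 1"
    using fin by (metis card_le_Suc0_iff_eq One_nat_def)
  then show "enat (card S) \<le> 1" by (simp add: one_enat_def)
qed

lemma rank_trivial_group:
  assumes "trivial_group G"
  shows "abelian_group_rank G = 0"
proof -
  have "card S = 0" if S: "int_independent G S" for S
  proof -
    have "S \<subseteq> {\<one>}"
      using S assms by (auto simp: int_independent_def trivial_group_def)
    then have "lincomb G (\<lambda>x. x) (\<lambda>_. 1) S = \<one>"
      by (intro finprod_one_eqI) auto
    then have "\<forall>x\<in>S. (1::int) = 0"
      using S unfolding int_independent_def by (elim conjE allE [of _ "\<lambda>_. 1"]) simp
    then show ?thesis by auto
  qed
  then have "abelian_group_rank G \<le> 0"
    unfolding abelian_group_rank_def by (intro SUP_least) (auto simp: zero_enat_def)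
  then show ?thesis by simp
qed

end

lemma hom_lincomb:
  assumes "comm_group A" "comm_group B" "f \<in> hom A B" "finite J" "x \<in> J \<rightarrow> carrier A"
  shows "f (lincomb A x c J) = lincomb B (f \<circ> x) c J"
proof -
  interpret A: comm_group A by fact
  interpret B: comm_group B by fact
  interpret group_hom A B f
    using assms by (simp add: group_hom_def group_hom_axioms_def A.is_group B.is_group)
  show ?thesis
    using assms(4,5)
  proof (induction J rule: finite_induct)
    case (insert j J)
    have "lincomb A x c (insert j J) = x j [^]\<^bsub>A\<^esub> c j \<otimes>\<^bsub>A\<^esub> lincomb A x c J"
      using insert by (intro A.finprod_insert) auto
    moreover have "lincomb B (f \<circ> x) c (insert j J)
        = (f \<circ> x) j [^]\<^bsub>B\<^esub> c j \<otimes>\<^bsub>B\<^esub> lincomb B (f \<circ> x) c J"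
      using insert by (intro B.finprod_insert) (auto simp: Pi_iff)
    ultimately show ?case
      using insert by (simp add: hom_int_pow hom_mult Pi_iff)
  qed auto
qed

text \<open>
  Rank is subadditive along \<open>A \<rightarrow> B \<rightarrow> C\<close> exact in the middle. Inside an independent set
  \<open>S\<close> of \<open>B\<close> choose a largest \<open>T\<close> whose image in \<open>C\<close> is independent; then \<open>T\<close> is counted by the
  rank of \<open>C\<close>. By maximality each \<open>s \<in> S - T\<close> has a nonzero multiple that agrees, up to a
  combination of \<open>T\<close>, with an element of the kernel, hence with the image of some \<open>a s\<close> in \<open>A\<close>.
  The coefficient matrix of these kernel elements is diagonal with nonzero entries on
  \<open>S - T\<close>, so the \<open>a s\<close> are independent.
\<close>

lemma rank_exact:
  assumes A: "comm_group A" and B: "comm_group B" and C: "comm_group C"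
    and f: "f \<in> hom A B" and g: "g \<in> hom B C" and exact: "kernel B C g \<subseteq> f ` carrier A"
  shows "abelian_group_rank B \<le> abelian_group_rank A + abelian_group_rank C"
  unfolding abelian_group_rank_def [of B]
proof (rule SUP_least, clarify)
  interpret A: comm_group A by fact
  interpret B: comm_group B by fact
  interpret C: comm_group C by fact
  fix S assume "int_independent B S"
  then have fin: "finite S" and car: "S \<subseteq> carrier B"
    and ind: "\<And>c. lincomb B (\<lambda>x. x) c S = \<one>\<^bsub>B\<^esub> \<Longrightarrow> \<forall>x\<in>S. c x = 0"
    by (auto simp: int_independent_def)
  define indep where "indep = (\<lambda>T. T \<subseteq> S \<and> independent_family C g T)"
  have "indep {}"
    by (auto simp: indep_def independent_family_def)
  moreover have "\<forall>T. indep T \<longrightarrow> card T \<le> card S"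
    using fin by (auto simp: indep_def card_mono)
  ultimately obtain T where T: "indep T" and Tmax: "\<And>T'. indep T' \<Longrightarrow> card T' \<le> card T"
    using ex_has_greatest_nat [of indep "{}" card "Suc (card S)"]
    by (auto simp: less_Suc_eq_le)
  have TS: "T \<subseteq> S" and finT: "finite T"
    using T fin by (auto simp: indep_def intro: finite_subset)
  have gcar: "g \<in> S \<rightarrow> carrier C"
    using g car by (auto simp: hom_def)
  define R where "R s e a \<longleftrightarrow> e s \<noteq> 0 \<and> (\<forall>t. t \<notin> insert s T \<longrightarrow> e t = 0) \<and>
      a \<in> carrier A \<and> lincomb B (\<lambda>x. x) e S = f a" for s e a
  have "\<exists>e a. R s e a" if s: "s \<in> S - T" for s
  proof -
    have "\<not> indep (insert s T)"
      using Tmax [of "insert s T"] s finT by auto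
    then obtain c where c: "lincomb C g c (insert s T) = \<one>\<^bsub>C\<^esub>" "\<not> (\<forall>j\<in>insert s T. c j = 0)"
      using s TS finT gcar by (auto simp: indep_def independent_family_def)
    have cs: "c s \<noteq> 0"
    proof
      assume "c s = 0"
      then have "lincomb C g c (insert s T) = lincomb C g c T"
        using TS s gcar by (intro C.lincomb_mono_neutral) (auto simp: finT)
      then have "\<forall>j\<in>T. c j = 0"
        using T c by (auto simp: indep_def independent_family_def)
      then show False using c \<open>c s = 0\<close> by auto
    qed
    define e where "e = (\<lambda>t. if t \<in> insert s T then c t else 0)"
    have "g (lincomb B (\<lambda>x. x) e S) = lincomb C g e S"
      using hom_lincomb [OF B C g fin, of "\<lambda>x. x" e] car by (simp add: o_def Pi_iff subset_iff)
    also have "\<dots> = lincomb C g e (insert s T)"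
      using s TS by (intro C.lincomb_mono_neutral fin gcar) (auto simp: e_def)
    also have "\<dots> = lincomb C g c (insert s T)"
      using s TS gcar by (intro C.finprod_cong') (auto simp: e_def)
    finally have "lincomb B (\<lambda>x. x) e S \<in> kernel B C g"
      using c(1) B.lincomb_closed [of "\<lambda>x. x" S e] car by (simp add: kernel_def Pi_iff subset_iff)
    then have "lincomb B (\<lambda>x. x) e S \<in> f ` carrier A"
      using exact by (rule subsetD [rotated])
    then obtain a where "a \<in> carrier A" "lincomb B (\<lambda>x. x) e S = f a"
      by (rule imageE)
    moreover have "e s \<noteq> 0" "\<forall>t. t \<notin> insert s T \<longrightarrow> e t = 0"
      using cs by (auto simp: e_def)
    ultimately have "R s e a" by (simp add: R_def)
    then show ?thesis by blast
  qed
  then obtain e a where "\<And>s. s \<in> S - T \<Longrightarrow> R s (e s) (a s)"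
    by metis
  then have e: "\<And>s. s \<in> S - T \<Longrightarrow> e s s \<noteq> 0"
      "\<And>s t. \<lbrakk>s \<in> S - T; t \<notin> insert s T\<rbrakk> \<Longrightarrow> e s t = 0"
    and a: "\<And>s. s \<in> S - T \<Longrightarrow> a s \<in> carrier A"
      "\<And>s. s \<in> S - T \<Longrightarrow> lincomb B (\<lambda>x. x) (e s) S = f (a s)"
    unfolding R_def by blast+
  have "independent_family A a (S - T)"
    unfolding independent_family_def
  proof (intro conjI allI impI)
    fix d assume "lincomb A a d (S - T) = \<one>\<^bsub>A\<^esub>"
    then have "lincomb B (f \<circ> a) d (S - T) = \<one>\<^bsub>B\<^esub>"
      using hom_lincomb [OF A B f, of "S - T" a d] a fin
      by (simp add: hom_one [OF f A.is_group B.is_group])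
    moreover have "lincomb B (f \<circ> a) d (S - T) = lincomb B (\<lambda>s. lincomb B (\<lambda>x. x) (e s) S) d (S - T)"
      using a car by (intro B.finprod_cong') (auto simp: hom_in_carrier [OF f])
    moreover have "\<dots> = lincomb B (\<lambda>x. x) (\<lambda>t. \<Sum>s\<in>S - T. d s * e s t) S"
      using fin car by (intro B.lincomb_lincomb) auto
    ultimately have z: "\<forall>t\<in>S. (\<Sum>s\<in>S - T. d s * e s t) = 0"
      by (intro ind) simp
    show "\<forall>t\<in>S - T. d t = 0"
    proof
      fix t assume t: "t \<in> S - T"
      have "(\<Sum>s\<in>S - T. d s * e s t) = (\<Sum>s\<in>{t}. d s * e s t)"
        using t fin e(2) by (intro sum.mono_neutral_right) auto
      then show "d t = 0" using z t e(1) by auto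
    qed
  qed (use fin a in auto)
  then have "enat (card (S - T)) \<le> abelian_group_rank A"
    by (rule A.card_le_rank)
  moreover have "enat (card T) \<le> abelian_group_rank C"
    using T by (intro C.card_le_rank [of g]) (auto simp: indep_def)
  moreover have "card S = card (S - T) + card T"
    using TS fin by (simp add: card_Diff_subset finT card_mono)
  ultimately show "enat (card S) \<le> abelian_group_rank A + abelian_group_rank C"
    by (metis add_mono plus_enat_simps(1))
qed

section \<open>Counting the faces of a hyperplane arrangement\<close>

text \<open>
  The pair \<open>(b, c)\<close> stands for the affine function \<open>x \<mapsto> b \<bullet> x + c\<close>, and so for the hyperplane
  on which it vanishes.
\<close>

definition affine_form :: "'a::euclidean_space \<times> real \<Rightarrow> 'a \<Rightarrow> real" where
  "affine_form h x = fst h \<bullet> x + snd h"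

text \<open>
  The fibres of the sign vector are the relatively open faces, of all dimensions, of the
  arrangement of the hyperplanes in \<open>H\<close>.
\<close>

definition sign_vector :: "('a::euclidean_space \<times> real) set \<Rightarrow> 'a \<Rightarrow> 'a \<times> real \<Rightarrow> real" where
  "sign_vector H x = (\<lambda>h\<in>H. sgn (affine_form h x))"

lemma affine_form_add:
  "u + v = 1 \<Longrightarrow> affine_form h (u *\<^sub>R x + v *\<^sub>R y) = u * affine_form h x + v * affine_form h y"
  by (simp add: affine_form_def inner_add_right algebra_simps flip: distrib_right)

lemma continuous_affine_form [continuous_intros]:
  "continuous_on S (affine_form h)"
  unfolding affine_form_def by (intro continuous_intros)

lemma affine_zero_affine_form:
  assumes "affine U" shows "affine {x\<in>U. \<forall>h\<in>H. affine_form h x = 0}"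
  using assms by (auto simp: affine_def affine_form_add)

lemma sgn_convex_combination:
  fixes a b :: real
  assumes "sgn a = s" "sgn b = s" "0 \<le> u" "0 \<le> v" "u + v = 1"
  shows "sgn (u * a + v * b) = s"
proof -
  consider "u = 0" | "v = 0" | "0 < u" "0 < v" using assms by linarith
  then show ?thesis
  proof cases
    case 3
    consider "0 < a" "0 < b" | "a = 0" "b = 0" | "a < 0" "b < 0"
      using assms(1,2) by (metis linorder_neqE_linordered_idom sgn_0_0 sgn_1_neg sgn_1_pos)
    then show ?thesis
    proof cases
      case 1
      then have "0 < u * a + v * b" using 3 by (intro add_pos_pos mult_pos_pos)
      then show ?thesis using 1 assms(1) by simp
    next
      case 2
      then show ?thesis using assms(1) by simp
    next
      case 3
      then have "u * a + v * b < 0" using \<open>0 < u\<close> \<open>0 < v\<close> by (intro add_neg_neg mult_pos_neg)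
      then show ?thesis using 3 assms(1) by simp
    qed
  qed (use assms in auto)
qed

lemma sign_vector_eq_iff:
  "sign_vector H x = sign_vector H y \<longleftrightarrow> (\<forall>h\<in>H. sgn (affine_form h x) = sgn (affine_form h y))"
  by (auto simp: sign_vector_def restrict_def fun_eq_iff)

lemma sign_vector_convex_combination:
  assumes "sign_vector H x = \<sigma>" "sign_vector H y = \<sigma>" "0 \<le> u" "0 \<le> v" "u + v = 1"
  shows "sign_vector H (u *\<^sub>R x + v *\<^sub>R y) = \<sigma>"
proof -
  have eq: "sgn (affine_form h y) = sgn (affine_form h x)" if "h \<in> H" for h
    using assms(1,2) that sign_vector_eq_iff [of H y x] by simp
  have "sgn (affine_form h (u *\<^sub>R x + v *\<^sub>R y)) = sgn (affine_form h x)" if "h \<in> H" for h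
    unfolding affine_form_add [OF assms(5)]
    by (rule sgn_convex_combination [OF refl eq [OF that] assms(3-5)])
  then show ?thesis
    unfolding assms(1) [symmetric] sign_vector_eq_iff by blast
qed

lemma sign_vector_insert:
  "sign_vector (insert k H) x = (sign_vector H x)(k := sgn (affine_form k x))"
  by (auto simp: sign_vector_def restrict_def fun_eq_iff)

lemma sgn_in_signs: "sgn (t::real) \<in> {-1, 0, 1}"
  by (auto simp: sgn_if)

lemma finite_sign_vectors:
  assumes "finite H" shows "finite (sign_vector H ` U)"
proof (rule finite_subset)
  show "sign_vector H ` U \<subseteq> H \<rightarrow>\<^sub>E {-1, 0, 1}"
    unfolding sign_vector_def
    by (intro image_subsetI restrict_PiE_iff [THEN iffD2] ballI sgn_in_signs)
  show "finite (H \<rightarrow>\<^sub>E {-1, 0, 1::real})"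
    using assms by (intro finite_PiE) auto
qed

text \<open>
  A face that lies on more than one side of a further hyperplane meets it: apply the
  intermediate value theorem along the segment between the two points, which stays in the face.
\<close>

lemma cell_meets_hyperplane:
  assumes "convex U" "x \<in> U" "y \<in> U" "sign_vector H x = \<sigma>" "sign_vector H y = \<sigma>"
    and "sgn (affine_form k x) \<noteq> sgn (affine_form k y)"
  shows "\<exists>z\<in>U. affine_form k z = 0 \<and> sign_vector H z = \<sigma>"
proof -
  let ?p = "affine_form k x" and ?q = "affine_form k y"
  consider "?p = 0" | "?q = 0" | "?p * ?q < 0"
    using assms(6) by (auto simp: sgn_if mult_less_0_iff not_less split: if_splits)
  then show ?thesis
  proof cases
    case 3
    \<comment> \<open>the point of the segment at which the affine function vanishes\<close>
    define u where "u = ?p / (?p - ?q)"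
    have ne: "?p - ?q \<noteq> 0" using 3 by auto
    have u: "0 \<le> u" "u \<le> 1"
      using 3 by (auto simp: u_def mult_less_0_iff divide_simps)
    let ?z = "(1 - u) *\<^sub>R x + u *\<^sub>R y"
    have "affine_form k ?z = ?p - u * (?p - ?q)"
      by (subst affine_form_add) (simp_all add: algebra_simps)
    also have "\<dots> = 0" using ne by (simp add: u_def)
    finally show ?thesis
      using assms u by (intro bexI [of _ ?z] conjI sign_vector_convex_combination convexD) auto
  qed (use assms in auto)
qed

text \<open>
  This is the number of faces of an arrangement of \<open>m\<close> hyperplanes in general position in
  dimension \<open>n\<close>.
\<close>

definition face_bound :: "nat \<Rightarrow> nat \<Rightarrow> nat" where
  "face_bound m n = (\<Sum>j\<le>n. 2 ^ j * (m choose j))"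

lemma face_bound_Suc_Suc:
  "face_bound (Suc m) (Suc n) = face_bound m (Suc n) + 2 * face_bound m n"
proof -
  have "face_bound (Suc m) (Suc n) = 1 + (\<Sum>j\<le>n. 2 ^ Suc j * (Suc m choose Suc j))"
    unfolding face_bound_def by (subst sum.atMost_Suc_shift) simp
  also have "\<dots> = (1 + (\<Sum>j\<le>n. 2 ^ Suc j * (m choose Suc j))) + (\<Sum>j\<le>n. 2 ^ Suc j * (m choose j))"
    by (simp add: algebra_simps sum.distrib)
  also have "1 + (\<Sum>j\<le>n. 2 ^ Suc j * (m choose Suc j)) = face_bound m (Suc n)"
    unfolding face_bound_def by (subst sum.atMost_Suc_shift) simp
  also have "(\<Sum>j\<le>n. 2 ^ Suc j * (m choose j)) = 2 * face_bound m n"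
    by (simp add: face_bound_def sum_distrib_left mult.assoc)
  finally show ?thesis .
qed

lemma face_bound_mono: "m \<le> m' \<Longrightarrow> face_bound m n \<le> face_bound m' n"
  unfolding face_bound_def by (intro sum_mono mult_left_mono binomial_right_mono) auto

text \<open>
  Add the hyperplanes one at a time. A new hyperplane cuts a face of the old arrangement into at
  most three pieces, and leaves it whole unless it meets it, in which case the face is counted
  once among the faces that the old hyperplanes induce on the new one, an affine space of
  smaller dimension. So the number of faces grows by at most twice the number of faces one
  dimension lower, which is the recursion of the bound. The statement is about an arbitrary
  affine \<open>U\<close> for the sake of this induction.
\<close>

lemma card_sign_vectors_le:
  assumes "finite H" "affine U" "aff_dim U \<le> int n"
  shows "card (sign_vector H ` U) \<le> face_bound (card H) n"
  using assms
proof (induction H arbitrary: U n rule: finite_induct)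
  case empty
  have "card (sign_vector {} ` U) \<le> card {\<lambda>_::'a \<times> real. undefined::real}"
    by (intro card_mono) (auto simp: sign_vector_def)
  also have "\<dots> \<le> face_bound 0 n"
    by (simp add: face_bound_def sum.atMost_shift)
  finally show ?case by simp
next
  case (insert k H)
  define S where "S = sign_vector H ` U"
  define U0 where "U0 = {x\<in>U. affine_form k x = 0}"
  define S0 where "S0 = sign_vector H ` U0"
  define e where "e = (\<lambda>\<sigma>. sgn (affine_form k (SOME x. x \<in> U \<and> sign_vector H x = \<sigma>)))"
  have finS: "finite S" and finS0: "finite S0"
    by (auto simp: S_def S0_def finite_sign_vectors insert.hyps)
  have e: "\<exists>y\<in>U. sign_vector H y = sign_vector H x \<and> e (sign_vector H x) = sgn (affine_form k y)"
    if "x \<in> U" for x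
    unfolding e_def using someI [of "\<lambda>y. y \<in> U \<and> sign_vector H y = sign_vector H x" x] that by blast
  \<comment> \<open>\<open>P\<close> holds one piece of every old face, \<open>Q\<close> the at most two further pieces of those that are cut\<close>
  define P where "P = (\<lambda>\<sigma>. \<sigma>(k := e \<sigma>)) ` S"
  define Q where "Q = (\<lambda>(\<sigma>, s). \<sigma>(k := s)) ` (SIGMA \<sigma>:S0. {-1, 0, 1} - {e \<sigma>})"
  have sub: "sign_vector (insert k H) x \<in> P \<union> Q" if "x \<in> U" for x
  proof (cases "sgn (affine_form k x) = e (sign_vector H x)")
    case True
    then show ?thesis
      using that by (auto simp: P_def S_def sign_vector_insert)
  next
    case False
    obtain y where y: "y \<in> U" "sign_vector H y = sign_vector H x"
        "e (sign_vector H x) = sgn (affine_form k y)"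
      using e [OF \<open>x \<in> U\<close>] by blast
    obtain z where "z \<in> U" "affine_form k z = 0" "sign_vector H z = sign_vector H x"
      using cell_meets_hyperplane [OF affine_imp_convex [OF insert.prems(1)] \<open>x \<in> U\<close> y(1) refl y(2), of k]
        False y(3) by auto
    then have "sign_vector H x \<in> S0"
      unfolding S0_def U0_def by (intro image_eqI [of _ _ z]) auto
    then have "(sign_vector H x, sgn (affine_form k x)) \<in> (SIGMA \<sigma>:S0. {-1, 0, 1} - {e \<sigma>})"
      using False sgn_in_signs by blast
    then show ?thesis
      unfolding Q_def by (intro UnI2 image_eqI) (auto simp: sign_vector_insert)
  qed
  have cardP: "card P \<le> card S"
    unfolding P_def by (rule card_image_le [OF finS])
  have "card ({-1, 0, 1} - {e \<sigma>}) = 2" for \<sigma>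
  proof -
    have "e \<sigma> \<in> {-1, 0, 1}" unfolding e_def by (rule sgn_in_signs)
    then show ?thesis by (subst card_Diff_singleton) simp_all
  qed
  then have "card Q \<le> 2 * card S0"
    unfolding Q_def using card_image_le [of "SIGMA \<sigma>:S0. {-1, 0, 1} - {e \<sigma>}"] finS0
    by (simp add: mult.commute)
  have finP: "finite P" and finQ: "finite Q"
    using finS finS0 by (auto simp: P_def Q_def)
  have IH: "card S \<le> face_bound (card H) n"
    unfolding S_def by (rule insert.IH [OF insert.prems])
  show ?case
  proof (cases "\<forall>x\<in>U. \<forall>y\<in>U. sgn (affine_form k x) = sgn (affine_form k y)")
    case True
    have "sign_vector (insert k H) ` U \<subseteq> P"
    proof (rule image_subsetI)
      fix x assume x: "x \<in> U"
      then have "sgn (affine_form k x) = e (sign_vector H x)"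
        using e [OF x] True by metis
      then show "sign_vector (insert k H) x \<in> P"
        using x by (auto simp: P_def S_def sign_vector_insert)
    qed
    then have "card (sign_vector (insert k H) ` U) \<le> face_bound (card H) n"
      using card_mono [OF finP] cardP IH by (meson order_trans)
    also have "\<dots> \<le> face_bound (card (insert k H)) n"
      by (intro face_bound_mono card_mono) (auto simp: insert.hyps)
    finally show ?thesis .
  next
    case False
    then obtain x y where xy: "x \<in> U" "y \<in> U" "sgn (affine_form k x) \<noteq> sgn (affine_form k y)"
      by blast
    have "U0 \<noteq> {}"
      using cell_meets_hyperplane [OF affine_imp_convex [OF insert.prems(1)] xy(1,2) refl _ xy(3), of "{}"]
      by (auto simp: U0_def sign_vector_eq_iff)
    have affU0: "affine U0"
      using affine_zero_affine_form [OF insert.prems(1), of "{k}"] by (simp add: U0_def)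
    have "x \<notin> U0 \<or> y \<notin> U0"
      using xy(3) by (auto simp: U0_def)
    then have "U0 \<subset> U"
      using xy(1,2) by (auto simp: U0_def)
    then have "aff_dim U0 < aff_dim U"
      by (intro aff_dim_psubset) (simp add: affU0 insert.prems(1) affine_hull_eq [THEN iffD2])
    moreover have "aff_dim U0 \<ge> 0"
      using \<open>U0 \<noteq> {}\<close> aff_dim_geq [of U0] aff_dim_empty [of U0] by force
    ultimately obtain n' where n': "n = Suc n'" "aff_dim U0 \<le> int n'"
      using insert.prems(2) by (cases n) auto
    have "card S0 \<le> face_bound (card H) n'"
      unfolding S0_def by (rule insert.IH [OF affU0 n'(2)])
    then have "card P + card Q \<le> face_bound (card H) (Suc n') + 2 * face_bound (card H) n'"
      using IH cardP \<open>card Q \<le> 2 * card S0\<close> by (simp add: n')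
    also have "\<dots> = face_bound (card (insert k H)) n"
      using insert.hyps by (simp add: n' face_bound_Suc_Suc)
    finally have "card P + card Q \<le> face_bound (card (insert k H)) n" .
    moreover have "card (sign_vector (insert k H) ` U) \<le> card (P \<union> Q)"
      using sub by (intro card_mono) (auto simp: finP finQ)
    ultimately show ?thesis
      using card_Un_le [of P Q] by linarith
  qed
qed

section \<open>Betti numbers after removing a cell\<close>

lemma rank_iso:
  assumes "comm_group G" "comm_group H" "h \<in> iso G H"
  shows "abelian_group_rank H \<le> abelian_group_rank G"
proof -
  let ?I = "singleton_group \<one>\<^bsub>H\<^esub>"
  interpret H: comm_group H by fact
  have I: "comm_group ?I"
    by simp
  have "abelian_group_rank H \<le> abelian_group_rank G + abelian_group_rank ?I"
  proof (rule rank_exact [OF assms(1,2) I])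
    show "h \<in> hom G H" using assms by (simp add: iso_def)
    show "(\<lambda>x. \<one>\<^bsub>?I\<^esub>) \<in> hom H ?I" by (rule trivial_hom) simp
    show "kernel H ?I (\<lambda>x. \<one>\<^bsub>?I\<^esub>) \<subseteq> h ` carrier G"
      using assms(3) by (auto simp: kernel_def iso_def bij_betw_def)
  qed
  moreover have "abelian_group_rank ?I = 0"
    by (intro comm_group.rank_trivial_group) simp_all
  ultimately show ?thesis by simp
qed

lemma rank_isomorphic:
  assumes "comm_group G" "comm_group H" "G \<cong> H"
  shows "abelian_group_rank H \<le> abelian_group_rank G"
  using assms rank_iso by (auto simp: is_iso_def)

text \<open>
  A relatively open convex set \<open>F\<close> of dimension \<open>q\<close> has the local homology of a \<open>q\<close>-cell: infinite
  cyclic in degree \<open>q\<close>, trivial elsewhere. For \<open>q > 0\<close> the set is contractible, so the boundary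
  map identifies the relative group with the reduced homology of \<open>F - {a}\<close> in degree \<open>p - 1\<close>; and
  \<open>F - {a}\<close> retracts onto a small sphere around \<open>a\<close> in the affine hull.
\<close>

lemma rank_relative_homology_punctured_cell:
  fixes F :: "'a::euclidean_space set"
  assumes E: "affine E" and ope: "openin (top_of_set E) F" and F: "convex F" and a: "a \<in> F"
  obtains q where "\<And>p. abelian_group_rank (relative_homology_group (int p) (top_of_set F) (F - {a}))
                      \<le> (if p = q then 1 else 0)"
proof (cases "F = {a}")
  case True
  have rel: "relative_homology_group (int p) (top_of_set F) (F - {a}) = homology_group (int p) (top_of_set {a})" for p
    by (simp add: True)
  have "abelian_group_rank (homology_group (int p) (top_of_set {a})) \<le> (if p = 0 then 1 else 0)" for p
  proof (cases "p = 0")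
    case True
    have "homology_group 0 (top_of_set {a}) \<cong> integer_group"
      by (rule homology_coefficients) simp
    then have "cyclic_group (homology_group 0 (top_of_set {a}))"
      by (subst isomorphic_group_cyclicity) auto
    then show ?thesis
      using True by (simp add: comm_group.rank_cyclic_group)
  next
    case False
    then have "trivial_group (homology_group (int p) (top_of_set {a}))"
      by (intro homology_dimension_axiom) auto
    then show ?thesis
      using False by (simp add: comm_group.rank_trivial_group)
  qed
  then show ?thesis using that [of 0] rel by metis
next
  case False
  have FE: "F \<subseteq> E" using ope openin_imp_subset by blast
  define q where "q = nat (aff_dim E)"
  have hull: "affine hull F = E"
    using affine_hull_openin [of E F] ope a E by (metis affine_hull_eq empty_iff)
  have "aff_dim F = aff_dim E" by (metis hull aff_dim_affine_hull)
  moreover have "aff_dim F > 0"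
    using False a aff_dim_eq_0 [of F] aff_dim_geq [of F] aff_dim_empty [of F] by force
  ultimately have q: "int q = aff_dim E" "q \<ge> 1" by (auto simp: q_def)
  obtain r where r: "r > 0" "cball a r \<inter> E \<subseteq> F"
    using ope a by (auto simp: openin_contains_cball)
  \<comment> \<open>the small ball around \<open>a\<close> in \<open>E\<close>, whose relative frontier is the sphere onto which \<open>F - {a}\<close> retracts\<close>
  define S where "S = E \<inter> cball a r"
  have int: "E \<inter> interior (cball a r) \<noteq> {}" using a FE r by auto
  have convE: "convex E" by (rule affine_imp_convex [OF E])
  have S: "convex S" "bounded S" "closed S"
    using E by (auto simp: S_def affine_imp_convex convex_Int affine_closed closed_Int bounded_Int)
  have hullS: "affine hull S = E"
    unfolding S_def using affine_hull_convex_Int_nonempty_interior [OF convE int] E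
    by (simp add: affine_hull_eq [THEN iffD2])
  have arel: "a \<in> rel_interior S"
  proof -
    have "rel_interior (cball a r) = ball a r"
      using r by (simp add: rel_interior_nonempty_interior)
    moreover have "a \<in> ball a r \<inter> E" using a FE r by auto
    ultimately have "rel_interior (cball a r \<inter> E) = rel_interior (cball a r) \<inter> E"
      by (intro convex_affine_rel_interior_Int E) auto
    with \<open>rel_interior (cball a r) = ball a r\<close> \<open>a \<in> ball a r \<inter> E\<close> show ?thesis
      by (simp add: S_def Int_commute)
  qed
  have eqv1: "rel_frontier S homotopy_eqv (F - {a})"
  proof (rule homotopy_eqv_rel_frontier_punctured_convex [OF S(1,2) arel F])
    show "rel_frontier S \<subseteq> F"
      using r S(3) by (auto simp: rel_frontier_def S_def)
    show "F \<subseteq> affine hull S" using FE hullS by simp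
  qed
  have "q \<le> card (Basis :: 'a set)"
    using q aff_dim_le_DIM [of E] by simp
  then obtain B :: "'a set" where B: "B \<subseteq> Basis" "card B = q"
    by (meson obtain_subset_with_card_n)
  have dimB: "aff_dim (span B) = int q"
    using B dim_eq_card_independent [of B] independent_mono [OF independent_Basis B(1)]
    by (simp add: aff_dim_subspace)
  \<comment> \<open>a standard ball of the same dimension, to compare the sphere with \<open>nsphere\<close>\<close>
  define S' where "S' = span B \<inter> cball 0 (1::real)"
  have int0: "span B \<inter> interior (cball 0 (1::real)) \<noteq> {}"
    using span_zero [of B] by force
  have aff_span: "affine (span B)" by (simp add: subspace_imp_affine)
  have "aff_dim S = int q" "aff_dim S' = int q"
    unfolding S_def S'_def
    using aff_dim_convex_Int_nonempty_interior [OF convE int]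
      aff_dim_convex_Int_nonempty_interior [OF affine_imp_convex [OF aff_span] int0] q dimB by auto
  then have "rel_frontier S homeomorphic rel_frontier S'"
    using S by (intro homeomorphic_rel_frontiers_convex_bounded_sets)
      (auto simp: S'_def convex_Int affine_imp_convex aff_span bounded_Int)
  also have "rel_frontier S' = sphere 0 1 \<inter> span B"
    unfolding S'_def using int0 aff_span
    by (subst Int_commute, subst convex_affine_rel_frontier_Int) (auto simp: Int_commute)
  finally have "rel_frontier S homeomorphic (sphere 0 1 \<inter> span B)" .
  moreover obtain f g where
    "homeomorphic_maps (nsphere (q - 1)) (top_of_set (sphere 0 1 \<inter> span B)) f g"
  proof (rule homeomorphic_maps_nsphere_euclidean_sphere [of B q])
    show "independent B" using B independent_Basis independent_mono by blast
    show "pairwise orthogonal B" using B orthogonal_Basis pairwise_subset by blast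
    show "norm u = 1" if "u \<in> B" for u using B that by auto
  qed (use B q in auto)
  then have "nsphere (q - 1) homeomorphic_space top_of_set (sphere 0 1 \<inter> span B)"
    unfolding homeomorphic_space_def by blast
  ultimately have "top_of_set (F - {a}) homotopy_equivalent_space nsphere (q - 1)"
    by (meson eqv1 homeomorphic_imp_homotopy_equivalent_space homeomorphic_space_iff_homeomorphic
        homotopy_equivalent_space_sym homotopy_eqv_trans)
  then have red: "reduced_homology_group p (top_of_set (F - {a})) \<cong> reduced_homology_group p (nsphere (q - 1))" for p
    by (rule homotopy_equivalent_space_imp_isomorphic_reduced_homology_groups)
  have rel: "relative_homology_group p (top_of_set F) (F - {a})
             \<cong> reduced_homology_group (p - 1) (nsphere (q - 1))" for p
  proof -
    have "topspace (top_of_set F) \<inter> (F - {a}) \<noteq> {}" using False a by auto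
    moreover have "contractible_space (top_of_set F)"
      using F by (simp add: convex_imp_contractible)
    ultimately have "relative_homology_group p (top_of_set F) (F - {a})
        \<cong> reduced_homology_group (p - 1) (subtopology (top_of_set F) (F - {a}))"
      by (intro isomorphic_group_relative_homology_of_contractible)
    also have "subtopology (top_of_set F) (F - {a}) = top_of_set (F - {a})"
      by (simp add: subtopology_subtopology Int_absorb1)
    finally show ?thesis using red iso_trans by blast
  qed
  have "abelian_group_rank (relative_homology_group (int p) (top_of_set F) (F - {a}))
        \<le> (if p = q then 1 else 0)" for p
  proof (cases "p = q")
    case True
    have "cyclic_group (relative_homology_group (int p) (top_of_set F) (F - {a}))"
      using isomorphic_group_cyclicity [OF rel] cyclic_reduced_homology_group_nsphere by simp
    then show ?thesis
      using True by (simp add: comm_group.rank_cyclic_group)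
  next
    case False
    then have "int p - 1 \<noteq> int (q - 1)" using q by auto
    then have "trivial_group (relative_homology_group (int p) (top_of_set F) (F - {a}))"
      using isomorphic_group_triviality [OF rel] trivial_reduced_homology_group_nsphere by simp
    then show ?thesis
      using False by (simp add: comm_group.rank_trivial_group)
  qed
  then show ?thesis using that by blast
qed

text \<open>
  Let \<open>F\<close> be a cell that is open in \<open>V\<close> and whose closure lies in \<open>V\<close>. Removing the centre \<open>a\<close>
  from \<open>V\<close> leaves a set that retracts onto \<open>V - F\<close> by pushing \<open>F - {a}\<close> radially to its frontier;
  excising \<open>V - F\<close> from the pair \<open>(V, V - {a})\<close> leaves \<open>(F, F - {a})\<close>. The exact sequence of the pair
  then gives the inequality. The cell is described by a gauge \<open>g\<close>, the factor by which \<open>F\<close> must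
  be dilated from \<open>a\<close> to reach a point: this makes the radial projection an explicit formula
  and shows that the straight-line homotopy is constant on the frontier, so that it extends by
  the identity to \<open>V - F\<close>.
\<close>

lemma betti_number_le_remove_cell:
  fixes V :: "'a::euclidean_space set" and g :: "'a \<Rightarrow> real"
  assumes E: "affine E" and a: "a \<in> E" and contg: "continuous_on UNIV g"
    and g_ray: "\<And>y t. \<lbrakk>y \<in> E; 0 \<le> t\<rbrakk> \<Longrightarrow> g (a + t *\<^sub>R (y - a)) = t * g y"
    and g_pos: "\<And>y. \<lbrakk>y \<in> E; y \<noteq> a\<rbrakk> \<Longrightarrow> 0 < g y"
    and D: "{y\<in>E. g y \<le> 1} \<subseteq> V"
    and F: "F = {y\<in>E. g y < 1}" and ope: "openin (top_of_set V) F"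
  shows "betti_number p (top_of_set V) \<le> betti_number p (top_of_set (V - F))
           + abelian_group_rank (relative_homology_group (int p) (top_of_set F) (F - {a}))"
proof -
  define T where "T = V - {a}"
  define X where "X = V - F"
  define D' where "D' = {y\<in>E. g y \<le> 1} - {a}"
  have ga: "g a = 0" using g_ray [OF a, of 0] by simp
  have aF: "a \<in> F" using a ga F by simp
  have FV: "F \<subseteq> V" using ope openin_imp_subset by blast
  have XT: "X \<subseteq> T" using aF by (auto simp: X_def T_def)
  have ray: "a + t *\<^sub>R (y - a) \<in> E" if "y \<in> E" for y t
    using mem_affine [OF E a that, of "1 - t" t] by (simp add: algebra_simps)
  define r where "r = (\<lambda>y. if y \<in> F then a + inverse (g y) *\<^sub>R (y - a) else y)"
  have T_eq: "T = D' \<union> X" using D FV aF by (auto simp: T_def X_def D'_def F)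
  have closedD: "closed {y\<in>E. g y \<le> 1}"
  proof -
    have "closed {y. g y \<le> 1}"
      using contg by (intro closed_Collect_le) auto
    then have "closed (E \<inter> {y. g y \<le> 1})" using affine_closed [OF E] by (intro closed_Int)
    then show ?thesis by (simp add: Collect_conj_eq)
  qed
  have closedX: "closedin (top_of_set V) X"
    unfolding X_def using ope
    by (metis closedin_diff closedin_subtopology_refl openin_closedin_eq topspace_euclidean_subtopology)
  have cont_r: "continuous_on T r"
    unfolding T_eq r_def
  proof (rule continuous_on_cases_local)
    have "D' = T \<inter> {y\<in>E. g y \<le> 1}" using D by (auto simp: D'_def T_def)
    then show "closedin (top_of_set (D' \<union> X)) D'"
      using closedD T_eq by (metis closedin_closed_Int)
    show "closedin (top_of_set (D' \<union> X)) X"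
      by (rule closedin_subset_trans [OF closedX]) (use T_eq T_def in auto)
    show "continuous_on D' (\<lambda>y. a + inverse (g y) *\<^sub>R (y - a))"
      using g_pos by (intro continuous_intros continuous_on_subset [OF contg]) (force simp: D'_def)+
    show "a + inverse (g y) *\<^sub>R (y - a) = y"
      if "y \<in> D' \<and> y \<notin> F \<or> y \<in> X \<and> y \<in> F" for y
      using that by (auto simp: D'_def F X_def)
  qed (intro continuous_intros)
  have rX: "r y \<in> X" if y: "y \<in> T" for y
  proof (cases "y \<in> F")
    case True
    then have y: "y \<in> E" "y \<noteq> a" using y by (auto simp: F T_def)
    have "g (r y) = 1"
      using True y g_ray [of y "inverse (g y)"] g_pos [of y] by (simp add: r_def)
    moreover have "r y \<in> E" using True y ray by (simp add: r_def)
    ultimately show ?thesis using D by (auto simp: X_def F)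
  qed (use y in \<open>auto simp: r_def X_def T_def\<close>)
  have seg: "closed_segment y (r y) \<subseteq> T" if y: "y \<in> T" for y
  proof (cases "y \<in> F")
    case True
    then have yE: "y \<in> E" "y \<noteq> a" and gy: "0 < g y" "g y < 1"
      using y g_pos by (auto simp: F T_def)
    show ?thesis
    proof
      fix z assume "z \<in> closed_segment y (r y)"
      then obtain u where u: "0 \<le> u" "u \<le> 1" "z = (1 - u) *\<^sub>R y + u *\<^sub>R r y"
        by (auto simp: in_segment)
      define t where "t = 1 - u + u * inverse (g y)"
      have z: "z = a + t *\<^sub>R (y - a)"
        using True by (simp add: u r_def t_def algebra_simps)
      have t: "0 \<le> t" using u gy by (simp add: t_def)
      \<comment> \<open>the gauge moves linearly from \<open>g y > 0\<close> to \<open>1\<close>, so the path avoids \<open>a\<close> and stays in the closed cell\<close>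
      have "g z = (1 - u) * g y + u"
        using gy by (simp add: z g_ray [OF yE(1) t]) (simp add: t_def algebra_simps)
      moreover have "(1 - u) * g y + u \<le> (1 - u) * 1 + u"
        using gy u by (intro add_right_mono mult_left_mono) auto
      moreover have "0 < (1 - u) * g y + u"
        using gy u by (cases "u = 0") (auto intro: add_nonneg_pos)
      ultimately have "g z \<le> 1" "z \<noteq> a" using ga by auto
      then show "z \<in> T" using D ray [OF yE(1), of t] by (auto simp: T_def z)
    qed
  qed (use y in \<open>simp add: r_def\<close>)
  have "homology_group (int p) (top_of_set T) \<cong> homology_group (int p) (top_of_set X)"
  proof (rule deformation_retract_imp_isomorphic_homology_groups)
    show "retraction_maps (top_of_set T) (top_of_set X) r id"
      using cont_r rX XT by (auto simp: retraction_maps_def r_def X_def continuous_map_in_subtopology)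
    have "homotopic_with_canon (\<lambda>_. True) T T id r"
      using seg by (intro homotopic_with_linear cont_r) (auto intro: continuous_on_id)
    then show "homotopic_with (\<lambda>_. True) (top_of_set T) (top_of_set T) r id"
      by (rule homotopic_with_symD)
  qed
  then have "homology_group (int p) (top_of_set X) \<cong> homology_group (int p) (top_of_set T)"
    by (simp add: group.iso_sym)
  then have rank_T: "abelian_group_rank (homology_group (int p) (top_of_set T)) \<le> betti_number p (top_of_set X)"
    unfolding betti_number_def by (intro rank_isomorphic) auto
  have sub_T: "subtopology (top_of_set V) T = top_of_set T"
    by (simp add: subtopology_subtopology T_def Int_absorb1)
  have "abelian_group_rank (homology_group (int p) (top_of_set V))
      \<le> abelian_group_rank (homology_group (int p) (top_of_set T))
        + abelian_group_rank (relative_homology_group (int p) (top_of_set V) T)"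
  proof (rule rank_exact)
    show "hom_induced (int p) (top_of_set T) {} (top_of_set V) {} id
       \<in> hom (homology_group (int p) (top_of_set T)) (homology_group (int p) (top_of_set V))"
      and "hom_induced (int p) (top_of_set V) {} (top_of_set V) T id
       \<in> hom (homology_group (int p) (top_of_set V)) (relative_homology_group (int p) (top_of_set V) T)"
      by (rule hom_induced_hom)+
    show "kernel (homology_group (int p) (top_of_set V)) (relative_homology_group (int p) (top_of_set V) T)
            (hom_induced (int p) (top_of_set V) {} (top_of_set V) T id)
          \<subseteq> hom_induced (int p) (top_of_set T) {} (top_of_set V) {} id ` carrier (homology_group (int p) (top_of_set T))"
      using homology_exactness_axiom_3 [of "int p" "top_of_set V" T] by (simp add: sub_T)
  qed auto
  moreover have "abelian_group_rank (relative_homology_group (int p) (top_of_set V) T)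
      \<le> abelian_group_rank (relative_homology_group (int p) (top_of_set F) (F - {a}))"
  proof (rule rank_iso)
    have "openin (top_of_set V) T"
      unfolding T_def by (simp add: openin_delete)
    then have "top_of_set V closure_of X \<subseteq> top_of_set V interior_of T"
      using XT closedX by (simp add: closure_of_closedin interior_of_openin)
    moreover have "V - X = F" "T - X = F - {a}" "T \<subseteq> V"
      using FV by (auto simp: X_def T_def)
    moreover have "subtopology (top_of_set V) F = top_of_set F"
      using FV by (simp add: subtopology_subtopology Int_absorb1)
    ultimately show "hom_induced (int p) (top_of_set F) (F - {a}) (top_of_set V) T id
       \<in> iso (relative_homology_group (int p) (top_of_set F) (F - {a}))
             (relative_homology_group (int p) (top_of_set V) T)"
      using homology_excision_axiom [of "top_of_set V" X T V "int p"]
      by (simp add: subtopology_subtopology)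
  qed auto
  ultimately show ?thesis
    using rank_T unfolding betti_number_def X_def by (meson add_mono order_trans)
qed

lemma sum_betti_numbers_le_Suc:
  assumes "\<And>p. betti_number p X \<le> betti_number p Y + (if p = q then 1 else 0)"
  shows "sum_betti_numbers X \<le> sum_betti_numbers Y + 1"
proof -
  let ?\<delta> = "\<lambda>p. if p = q then 1 else (0::ereal)"
  have "sum_betti_numbers X \<le> suminf (\<lambda>p. ereal_of_enat (betti_number p Y) + ?\<delta> p)"
    unfolding sum_betti_numbers_def
  proof (rule suminf_le_pos)
    fix p
    have "ereal_of_enat (betti_number p X) \<le> ereal_of_enat (betti_number p Y + (if p = q then 1 else 0))"
      using assms by simp
    also have "\<dots> = ereal_of_enat (betti_number p Y) + ?\<delta> p"
      by (simp add: ereal_of_enat_add one_enat_def flip: one_ereal_def)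
    finally show "ereal_of_enat (betti_number p X) \<le> ereal_of_enat (betti_number p Y) + ?\<delta> p" .
  qed simp
  also have "\<dots> = sum_betti_numbers Y + suminf ?\<delta>"
    unfolding sum_betti_numbers_def by (rule suminf_add_ereal) auto
  also have "suminf ?\<delta> = 1"
    by (subst suminf_finite [of "{q}"]) auto
  finally show ?thesis .
qed

section \<open>Unions of faces of an arrangement\<close>

text \<open>
  A face is a cell in the sense required for its removal. It is cut out of the affine space \<open>E\<close>
  by strict inequalities, and with respect to one of its points \<open>a\<close> the gauge is the maximum of
  the functions \<open>1 - h / h(a)\<close> over the affine functions \<open>h\<close> that do not vanish at \<open>a\<close>. Since \<open>F\<close> lies
  in a compact set it contains no ray, so the gauge is positive away from \<open>a\<close>.
\<close>

lemma betti_number_le_remove_sign_cell: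
  fixes H :: "('a::euclidean_space \<times> real) set" and V :: "'a set"
  assumes H: "finite H" and V: "compact V"
    and a: "sign_vector H a = \<sigma>" and N: "open N" and F: "{x. sign_vector H x = \<sigma>} = V \<inter> N"
  shows "\<exists>q. \<forall>p. betti_number p (top_of_set V)
      \<le> betti_number p (top_of_set (V - {x. sign_vector H x = \<sigma>})) + (if p = q then 1 else 0)"
proof -
  define F where "F = {x. sign_vector H x = \<sigma>}"
  define P where "P = {h\<in>H. affine_form h a \<noteq> 0}"
  define E where "E = {x \<in> UNIV. \<forall>h\<in>H - P. affine_form h x = 0}"
  define \<phi> where "\<phi> = (\<lambda>h x. 1 - affine_form h x / affine_form h a)"
  \<comment> \<open>the value \<open>0\<close> is included because \<open>P\<close> is empty when \<open>F\<close> is a single point with \<open>E = F\<close>\<close>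
  define g where "g = (\<lambda>x. Max (insert 0 ((\<lambda>h. \<phi> h x) ` P)))"
  have finP: "finite P" using H by (simp add: P_def)
  have affE: "affine E" unfolding E_def by (rule affine_zero_affine_form) simp
  have aE: "a \<in> E" by (auto simp: E_def P_def)
  have FV: "F \<subseteq> V" and aF: "a \<in> F" using F a by (auto simp: F_def)
  have g_less: "g x < c \<longleftrightarrow> 0 < c \<and> (\<forall>h\<in>P. \<phi> h x < c)" for x c
    using finP by (simp add: g_def)
  have \<phi>_less: "\<phi> h x < 1 \<longleftrightarrow> sgn (affine_form h x) = sgn (affine_form h a)" if "h \<in> P" for h x
    using that by (auto simp: \<phi>_def P_def sgn_if zero_less_divide_iff split: if_splits)
  have F_eq: "F = {x\<in>E. g x < 1}"
  proof -
    have "sign_vector H x = \<sigma> \<longleftrightarrow> x \<in> E \<and> g x < 1" for x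
    proof -
      have "sign_vector H x = \<sigma> \<longleftrightarrow> (\<forall>h\<in>H. sgn (affine_form h x) = sgn (affine_form h a))"
        using a by (metis sign_vector_eq_iff)
      also have "\<dots> \<longleftrightarrow> (\<forall>h\<in>H - P. sgn (affine_form h x) = sgn (affine_form h a))
                   \<and> (\<forall>h\<in>P. sgn (affine_form h x) = sgn (affine_form h a))"
        unfolding P_def by blast
      also have "\<dots> \<longleftrightarrow> x \<in> E \<and> g x < 1"
        using \<phi>_less by (auto simp: E_def P_def g_less sgn_0_0)
      finally show ?thesis .
    qed
    then show ?thesis by (auto simp: F_def)
  qed
  have contg: "continuous_on UNIV g"
  proof -
    have "continuous_on UNIV (\<lambda>x. Max (insert 0 ((\<lambda>h. \<phi> h x) ` Q)))" if "finite Q" for Q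
      using that
    proof (induction Q rule: finite_induct)
      case (insert h Q)
      have "Max (insert 0 ((\<lambda>h. \<phi> h x) ` insert h Q)) = max (\<phi> h x) (Max (insert 0 ((\<lambda>h. \<phi> h x) ` Q)))" for x
        using insert.hyps by (simp add: insert_commute [of 0] del: Max_insert) (simp add: Max_insert)
      then show ?case
        using insert.IH unfolding \<phi>_def
        by (auto simp: divide_inverse intro!: continuous_intros)
    qed simp
    then show ?thesis unfolding g_def using finP by blast
  qed
  have ray_form: "affine_form h (a + t *\<^sub>R (y - a)) = (1 - t) * affine_form h a + t * affine_form h y" for h t y
    using affine_form_add [of "1 - t" t h a y] by (simp add: algebra_simps)
  have rayE: "a + t *\<^sub>R (y - a) \<in> E" if "y \<in> E" for t y
    using mem_affine [OF affE aE that, of "1 - t" t] by (simp add: algebra_simps)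
  have \<phi>_ray: "\<phi> h (a + t *\<^sub>R (y - a)) = t * \<phi> h y" if "h \<in> P" for h t y
  proof -
    have "affine_form h a \<noteq> 0" using that by (simp add: P_def)
    then show ?thesis unfolding \<phi>_def ray_form by (simp add: field_simps)
  qed
  have g_ray: "g (a + t *\<^sub>R (y - a)) = t * g y" if "0 \<le> t" for t y
  proof -
    have "t * g y = Max ((\<lambda>s. t * s) ` insert 0 ((\<lambda>h. \<phi> h y) ` P))"
      unfolding g_def using that finP by (intro mono_Max_commute) (auto simp: mono_def mult_left_mono)
    also have "(\<lambda>s. t * s) ` insert 0 ((\<lambda>h. \<phi> h y) ` P) = insert 0 ((\<lambda>h. \<phi> h (a + t *\<^sub>R (y - a))) ` P)"
      by (auto simp: \<phi>_ray image_iff)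
    finally show ?thesis by (simp add: g_def)
  qed
  have g_nonneg: "0 \<le> g y" for y using finP by (simp add: g_def)
  have bounded: "bounded F"
    using FV V bounded_subset compact_imp_bounded by blast
  have g_pos: "0 < g y" if y: "y \<in> E" "y \<noteq> a" for y
  proof (rule ccontr)
    assume "\<not> 0 < g y"
    then have g0: "g y = 0" using g_nonneg [of y] by simp
    obtain b where b: "\<And>x. x \<in> F \<Longrightarrow> norm x \<le> b" using bounded by (auto simp: bounded_iff)
    \<comment> \<open>far enough along the ray to leave the ball of radius \<open>b\<close>\<close>
    define t where "t = (b + norm a + 1) / norm (y - a)"
    have "0 \<le> b" using b [OF aF] norm_ge_zero order_trans by blast
    then have t: "0 \<le> t" "t * norm (y - a) = b + norm a + 1"
      using y by (auto simp: t_def)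
    have "a + t *\<^sub>R (y - a) \<in> F"
      using rayE [OF y(1)] by (simp add: F_eq g_ray [OF t(1)] g0)
    then have "norm (a + t *\<^sub>R (y - a)) \<le> b" by (rule b)
    moreover have "norm (t *\<^sub>R (y - a)) \<le> norm (a + t *\<^sub>R (y - a)) + norm a"
      by (metis add_diff_cancel_left' norm_triangle_ineq4)
    ultimately show False using t by simp
  qed
  have D: "{y\<in>E. g y \<le> 1} \<subseteq> V"
  proof clarify
    fix y assume y: "y \<in> E" "g y \<le> 1"
    have "(\<lambda>n. a + (1 - inverse (real (Suc n))) *\<^sub>R (y - a)) \<longlonglongrightarrow> a + (1 - 0) *\<^sub>R (y - a)"
      by (intro tendsto_intros LIMSEQ_inverse_real_of_nat)
    moreover have "a + (1 - inverse (real (Suc n))) *\<^sub>R (y - a) \<in> V" for n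
    proof -
      define t where "t = 1 - inverse (real (Suc n))"
      have t: "0 \<le> t" "t < 1" by (auto simp: t_def divide_simps)
      have "t * g y \<le> t" using y t by (simp add: mult_left_le)
      then have "a + t *\<^sub>R (y - a) \<in> F"
        using rayE [OF y(1)] t by (simp add: F_eq g_ray)
      then show ?thesis using FV by (auto simp: t_def)
    qed
    ultimately show "y \<in> V"
      using compact_imp_closed [OF V] unfolding closed_sequential_limits
      by (metis (no_types, lifting) add_diff_cancel_left' diff_zero scaleR_one add_diff_eq)
  qed
  have open_g: "open {y. g y < 1}"
    by (intro open_Collect_less contg continuous_on_const)
  have "openin (top_of_set E) F"
    using open_g by (auto simp: F_eq openin_open Collect_conj_eq)
  moreover have "convex F"
    by (auto simp: convex_def F_def sign_vector_convex_combination)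
  ultimately obtain q where q: "\<And>p. abelian_group_rank (relative_homology_group (int p) (top_of_set F) (F - {a}))
      \<le> (if p = q then 1 else 0)"
    using rank_relative_homology_punctured_cell [OF affE _ _ aF] by metis
  have ope: "openin (top_of_set V) F"
    unfolding F_def F using N by (simp add: openin_open_Int)
  have "betti_number p (top_of_set V) \<le> betti_number p (top_of_set (V - F)) + (if p = q then 1 else 0)" for p
    using betti_number_le_remove_cell [OF affE aE contg g_ray g_pos D F_eq ope, of p] q [of p]
    by (meson add_left_mono order_trans)
  then show ?thesis unfolding F_def by blast
qed

text \<open>
  Remove the faces one at a time, each time a face on which as few affine functions as possible
  vanish. Near a point of it no further function can vanish, so by minimality a nearby point of
  \<open>V\<close> has the same sign vector: the face is open in \<open>V\<close>, what remains is again compact, and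
  the sum of the Betti numbers has dropped by at most one.
\<close>

lemma sum_betti_numbers_le_card_cells:
  fixes H :: "('a::euclidean_space \<times> real) set" and V :: "'a set"
  assumes H: "finite H" and "finite C" and "C \<subseteq> range (sign_vector H)"
    and "V = {x. sign_vector H x \<in> C}" and "compact V"
  shows "sum_betti_numbers (top_of_set V) \<le> ereal (real (card C))"
  using assms(2-)
proof (induction "card C" arbitrary: C V)
  case 0
  then have "V = {}" by simp
  then have "betti_number p (top_of_set V) = 0" for p
    unfolding betti_number_def
    by (intro comm_group.rank_trivial_group trivial_homology_group_empty) auto
  then show ?case by (simp add: sum_betti_numbers_def)
next
  case (Suc n)
  define Z where "Z = (\<lambda>\<sigma>::'a \<times> real \<Rightarrow> real. {h\<in>H. \<sigma> h = 0})"
  obtain \<sigma>\<^sub>0 where "\<sigma>\<^sub>0 \<in> C" using Suc.hyps(2) by fastforce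
  then obtain \<sigma> where \<sigma>: "\<sigma> \<in> C" "\<And>\<tau>. \<tau> \<in> C \<Longrightarrow> card (Z \<sigma>) \<le> card (Z \<tau>)"
    using ex_has_least_nat [of "\<lambda>\<tau>. \<tau> \<in> C" \<sigma>\<^sub>0 "\<lambda>\<tau>. card (Z \<tau>)"] by blast
  obtain a where a: "sign_vector H a = \<sigma>" using \<sigma>(1) Suc.prems(2) by auto
  define N where "N = (\<Inter>h\<in>H - Z \<sigma>. {x. 0 < \<sigma> h * affine_form h x})"
  have "open N"
    unfolding N_def using H by (intro open_INT ballI open_Collect_less continuous_intros) auto
  have in_N: "x \<in> N \<longleftrightarrow> (\<forall>h\<in>H - Z \<sigma>. sgn (affine_form h x) = \<sigma> h)" for x
  proof -
    have "0 < \<sigma> h * affine_form h x \<longleftrightarrow> sgn (affine_form h x) = \<sigma> h" if "h \<in> H - Z \<sigma>" for h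
    proof -
      have "\<sigma> h = sgn (affine_form h a)" "\<sigma> h \<noteq> 0"
        using that a by (auto simp: Z_def sign_vector_def)
      then consider "\<sigma> h = 1" | "\<sigma> h = -1" using sgn_in_signs [of "affine_form h a"] by auto
      then show ?thesis by cases (auto simp: sgn_1_pos sgn_1_neg)
    qed
    then show ?thesis by (auto simp: N_def)
  qed
  have F: "{x. sign_vector H x = \<sigma>} = V \<inter> N"
  proof (intro equalityI subsetI)
    fix x assume "x \<in> {x. sign_vector H x = \<sigma>}"
    then show "x \<in> V \<inter> N"
      using \<sigma>(1) Suc.prems(3) by (simp add: in_N) (auto simp: sign_vector_def)
  next
    fix x assume x: "x \<in> V \<inter> N"
    have "Z (sign_vector H x) \<subseteq> Z \<sigma>"
    proof
      fix h assume h: "h \<in> Z (sign_vector H x)"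
      then have "h \<in> H" "sgn (affine_form h x) = 0" by (auto simp: Z_def sign_vector_def)
      then show "h \<in> Z \<sigma>" using x in_N [of x] by (cases "h \<in> Z \<sigma>") (auto simp: Z_def)
    qed
    moreover have "card (Z \<sigma>) \<le> card (Z (sign_vector H x))"
      using x Suc.prems(3) by (intro \<sigma>) simp
    ultimately have "Z (sign_vector H x) = Z \<sigma>"
      using H by (intro card_seteq) (auto simp: Z_def)
    then have "sgn (affine_form h x) = \<sigma> h" if "h \<in> H" for h
    proof (cases "h \<in> Z \<sigma>")
      case True
      then have "h \<in> Z (sign_vector H x)" using \<open>Z (sign_vector H x) = Z \<sigma>\<close> by simp
      then show ?thesis using True that by (simp add: Z_def sign_vector_def)
    qed (use x in_N [of x] that in auto)
    then have "sign_vector H x = sign_vector H a"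
      unfolding sign_vector_eq_iff a [symmetric] by (simp add: sign_vector_def)
    then show "x \<in> {x. sign_vector H x = \<sigma>}" using a by simp
  qed
  obtain q where q: "\<forall>p. betti_number p (top_of_set V)
      \<le> betti_number p (top_of_set (V - {x. sign_vector H x = \<sigma>})) + (if p = q then 1 else 0)"
    using betti_number_le_remove_sign_cell [OF H Suc.prems(4) a \<open>open N\<close> F] by (rule exE)
  have "sum_betti_numbers (top_of_set V)
      \<le> sum_betti_numbers (top_of_set (V - {x. sign_vector H x = \<sigma>})) + 1"
    by (rule sum_betti_numbers_le_Suc [OF q [THEN spec]])
  moreover have "sum_betti_numbers (top_of_set (V - {x. sign_vector H x = \<sigma>})) \<le> ereal (real (card (C - {\<sigma>})))"
  proof (rule Suc.hyps(1))
    show "n = card (C - {\<sigma>})" using Suc.hyps(2) \<sigma>(1) by simp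
    show "V - {x. sign_vector H x = \<sigma>} = {x. sign_vector H x \<in> C - {\<sigma>}}"
      using Suc.prems(3) by auto
    have "V - {x. sign_vector H x = \<sigma>} = V - N" using F by auto
    then show "compact (V - {x. sign_vector H x = \<sigma>})"
      using Suc.prems(4) \<open>open N\<close> by (simp add: compact_diff)
    show "finite (C - {\<sigma>})" using Suc.prems(1) by simp
    show "C - {\<sigma>} \<subseteq> range (sign_vector H)" using Suc.prems(2) by blast
  qed
  ultimately have "sum_betti_numbers (top_of_set V) \<le> ereal (real (card (C - {\<sigma>}))) + 1"
    by (rule order_trans [OF _ add_right_mono])
  also have "\<dots> = ereal (real (card C))"
  proof -
    have "real (card C) = real (card (C - {\<sigma>})) + 1"
      using \<sigma>(1) Suc.hyps(2) [symmetric] by simp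
    then show ?thesis by (simp add: one_ereal_def)
  qed
  finally show ?case .
qed

section \<open>Tropical prevarieties\<close>

text \<open>
  Stars and bars: appending \<open>d - monomial_degree i\<close> to the entries of \<open>i\<close> gives a list of length
  \<open>n + 1\<close> with sum exactly \<open>d\<close>.
\<close>

lemma card_exponents_le:
  "finite {i :: nat ^ 'n::finite. monomial_degree i \<le> d}"
  "card {i :: nat ^ 'n::finite. monomial_degree i \<le> d} \<le> (CARD('n) + d) choose CARD('n)"
proof -
  let ?n = "CARD('n)"
  let ?I = "{i :: nat ^ 'n. monomial_degree i \<le> d}"
  let ?L = "{l :: nat list. length l = Suc ?n \<and> sum_list l = d}"
  obtain xs :: "'n list" where xs: "set xs = UNIV" "distinct xs"
    using finite_distinct_list [of "UNIV :: 'n set"] by auto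
  define \<Phi> where "\<Phi> = (\<lambda>i :: nat ^ 'n. map (($) i) xs @ [d - monomial_degree i])"
  have len: "length xs = ?n"
    using xs by (metis distinct_card)
  have inj: "inj_on \<Phi> ?I"
  proof
    fix i j assume "\<Phi> i = \<Phi> j"
    then have "map (($) i) xs = map (($) j) xs" by (simp add: \<Phi>_def)
    then show "i = j" using xs by (simp add: vec_eq_iff)
  qed
  have "sum_list (map (($) i) xs) = monomial_degree i" for i
    using xs by (simp add: monomial_degree_def sum_list_distinct_conv_sum_set)
  then have sub: "\<Phi> ` ?I \<subseteq> ?L"
    by (auto simp: \<Phi>_def len)
  have finL: "finite ?L"
  proof (rule finite_subset)
    show "?L \<subseteq> {l. set l \<subseteq> {..d} \<and> length l = Suc ?n}"
      by (auto intro: member_le_sum_list)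
  qed (simp add: finite_lists_length_eq)
  show "finite ?I"
    using finite_subset [OF sub finL] inj finite_imageD by blast
  have "card ?I \<le> card ?L"
    using card_mono [OF finL sub] card_image [OF inj] by simp
  also have "\<dots> = (d + Suc ?n - 1) choose d"
    by (rule card_length_sum_list)
  also have "\<dots> = (?n + d) choose ?n"
    using binomial_symmetric [of d "?n + d"] by (simp add: add.commute)
  finally show "card ?I \<le> (?n + d) choose ?n" .
qed

lemma tropical_zero_iff:
  assumes "tropical_polynomial f"
  shows "tropical_zero f x \<longleftrightarrow> (\<exists>i\<in>dom f. \<exists>j\<in>dom f. i \<noteq> j \<and>
           (\<forall>k\<in>dom f. monomial_value f i x \<le> monomial_value f k x) \<and>
           (\<forall>k\<in>dom f. monomial_value f j x \<le> monomial_value f k x))"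
proof -
  let ?A = "(\<lambda>i. monomial_value f i x) ` dom f"
  have "finite ?A" "?A \<noteq> {}"
    using assms by (auto simp: tropical_polynomial_def)
  then have "monomial_value f i x = tropical_value f x
      \<longleftrightarrow> (\<forall>k\<in>dom f. monomial_value f i x \<le> monomial_value f k x)" if "i \<in> dom f" for i
    using that unfolding tropical_value_def by (subst eq_Min_iff) auto
  then show ?thesis
    unfolding tropical_zero_def by meson
qed

text \<open>
  The difference of two monomials of \<open>f\<close>, encoded as an affine function.
\<close>

definition monomial_difference :: "'n::finite trop_poly \<Rightarrow> nat ^ 'n \<Rightarrow> nat ^ 'n \<Rightarrow> (real ^ 'n) \<times> real" where
  "monomial_difference f i j = ((\<chi> l. real (i $ l) - real (j $ l)), the (f i) - the (f j))"

lemma affine_form_monomial_difference: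
  "affine_form (monomial_difference f i j) x = monomial_value f i x - monomial_value f j x"
  by (simp add: affine_form_def monomial_difference_def monomial_value_def inner_vec_def
      left_diff_distrib sum_subtractf)

definition monomial_differences :: "'n::finite trop_poly list \<Rightarrow> ((real ^ 'n) \<times> real) set" where
  "monomial_differences fs =
     (\<Union>f\<in>set fs. (\<lambda>(i, j). monomial_difference f i j) ` (dom f \<times> dom f))"

lemma finite_monomial_differences:
  assumes "\<forall>f\<in>set fs. tropical_polynomial f"
  shows "finite (monomial_differences fs)"
  using assms by (auto simp: monomial_differences_def tropical_polynomial_def)

lemma card_monomial_differences_le:
  fixes fs :: "'n::finite trop_poly list"
  assumes "\<forall>f\<in>set fs. tropical_polynomial f \<and> tropical_degree f \<le> d"
  shows "card (monomial_differences fs) \<le> length fs * ((CARD('n) + d) choose CARD('n))\<^sup>2"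
proof -
  let ?N = "(CARD('n) + d) choose CARD('n)"
  have "card ((\<lambda>(i, j). monomial_difference f i j) ` (dom f \<times> dom f)) \<le> ?N\<^sup>2" if f: "f \<in> set fs" for f
  proof -
    have fin: "finite (dom f)" using assms f by (simp add: tropical_polynomial_def)
    have "dom f \<subseteq> {i. monomial_degree i \<le> d}"
    proof
      fix i assume "i \<in> dom f"
      then have "monomial_degree i \<le> tropical_degree f"
        using fin unfolding tropical_degree_def by (intro Max_ge) auto
      then show "i \<in> {i. monomial_degree i \<le> d}" using assms f by force
    qed
    then have "card (dom f) \<le> ?N"
      using card_exponents_le order_trans card_mono by blast
    moreover have "card ((\<lambda>(i, j). monomial_difference f i j) ` (dom f \<times> dom f)) \<le> card (dom f \<times> dom f)"
      using fin by (intro card_image_le) simp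
    ultimately show ?thesis
      by (simp add: card_cartesian_product power2_eq_square mult_le_mono order_trans)
  qed
  then have "(\<Sum>f\<in>set fs. card ((\<lambda>(i, j). monomial_difference f i j) ` (dom f \<times> dom f))) \<le> card (set fs) * ?N\<^sup>2"
    using sum_bounded_above [of "set fs" _ "?N\<^sup>2"] by simp
  moreover have "card (monomial_differences fs)
      \<le> (\<Sum>f\<in>set fs. card ((\<lambda>(i, j). monomial_difference f i j) ` (dom f \<times> dom f)))"
    unfolding monomial_differences_def by (rule card_UN_le) simp
  ultimately show ?thesis
    using card_length [of fs] by (meson mult_le_mono1 order_trans)
qed

text \<open>
  Where the minimum of \<open>f\<close> is attained depends only on the order of the values of the monomials,
  hence on the signs of their differences.
\<close>

lemma tropical_prevariety_union_of_cells:
  assumes "\<forall>f\<in>set fs. tropical_polynomial f"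
    and "sign_vector (monomial_differences fs) x = sign_vector (monomial_differences fs) y"
    and "x \<in> tropical_prevariety fs"
  shows "y \<in> tropical_prevariety fs"
proof -
  have le_iff: "monomial_value f i y \<le> monomial_value f j y \<longleftrightarrow> monomial_value f i x \<le> monomial_value f j x"
    if "f \<in> set fs" "i \<in> dom f" "j \<in> dom f" for f i j
  proof -
    have "monomial_difference f i j \<in> monomial_differences fs"
      using that by (auto simp: monomial_differences_def)
    then have "sgn (monomial_value f i x - monomial_value f j x) = sgn (monomial_value f i y - monomial_value f j y)"
      using assms(2) unfolding sign_vector_eq_iff affine_form_monomial_difference [symmetric] by blast
    then show ?thesis by (auto simp: sgn_if split: if_splits)
  qed
  have "tropical_zero f y" if f: "f \<in> set fs" for f
  proof -
    have "tropical_zero f x" "tropical_polynomial f"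
      using assms f by (auto simp: tropical_prevariety_def)
    then show ?thesis
      using le_iff [OF f] by (simp add: tropical_zero_iff)
  qed
  then show ?thesis by (simp add: tropical_prevariety_def)
qed

lemma sum_betti_numbers_tropical_prevariety_le:
  fixes fs :: "'n::finite trop_poly list"
  assumes trop: "\<forall>f\<in>set fs. tropical_polynomial f \<and> tropical_degree f \<le> d"
    and V: "compact (tropical_prevariety fs)"
  shows "sum_betti_numbers (top_of_set (tropical_prevariety fs))
           \<le> ereal (real (face_bound (length fs * ((CARD('n) + d) choose CARD('n))\<^sup>2) (CARD('n))))"
proof -
  let ?H = "monomial_differences fs"
  let ?V = "tropical_prevariety fs"
  let ?C = "sign_vector ?H ` ?V"
  have finH: "finite ?H" using trop by (simp add: finite_monomial_differences)
  have V_eq: "?V = {x. sign_vector ?H x \<in> ?C}"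
  proof (intro equalityI subsetI)
    fix x assume "x \<in> {x. sign_vector ?H x \<in> ?C}"
    then obtain y where "y \<in> ?V" "sign_vector ?H y = sign_vector ?H x" by auto
    then show "x \<in> ?V"
      using tropical_prevariety_union_of_cells [of fs y x] trop by blast
  qed auto
  have "sum_betti_numbers (top_of_set ?V) \<le> ereal (real (card ?C))"
    by (rule sum_betti_numbers_le_card_cells [OF finH _ _ V_eq V])
      (auto simp: finite_sign_vectors finH)
  moreover have "card ?C \<le> face_bound (length fs * ((CARD('n) + d) choose CARD('n))\<^sup>2) (CARD('n))"
  proof -
    have "card ?C \<le> card (sign_vector ?H ` UNIV)"
      by (intro card_mono finite_sign_vectors finH) auto
    also have "\<dots> \<le> face_bound (card ?H) (CARD('n))"
      by (intro card_sign_vectors_le finH) auto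
    also have "\<dots> \<le> face_bound (length fs * ((CARD('n) + d) choose CARD('n))\<^sup>2) (CARD('n))"
      using trop by (intro face_bound_mono card_monomial_differences_le)
    finally show ?thesis .
  qed
  ultimately show ?thesis
    by (meson ereal_less_eq(3) of_nat_mono order_trans)
qed

text \<open>
  The terms of the face bound below the top one have order at most \<open>n - 1\<close>.
\<close>

lemma face_bound_remainder_smallo:
  "(\<lambda>m. \<Sum>j<n. 2 ^ j * real (m choose j)) \<in> o(\<lambda>m. real m ^ n)"
proof (rule big_sum_in_smallo)
  fix j assume "j \<in> {..<n}"
  then have j: "j < n" by simp
  have "(\<lambda>m. 2 ^ j * real (m choose j)) \<in> O(\<lambda>m. real m ^ j)"
  proof (rule bigoI)
    have "real (m choose j) \<le> real m ^ j" for m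
      by (cases "j \<le> m") (auto simp: binomial_le_pow binomial_eq_0 simp flip: of_nat_power)
    then show "\<forall>\<^sub>F m in sequentially. norm (2 ^ j * real (m choose j)) \<le> 2 ^ j * norm (real m ^ j)"
      by (intro always_eventually) simp
  qed
  also have "(\<lambda>m. real m ^ j) \<in> o(\<lambda>m. real m ^ n)"
  proof (rule smalloI_tendsto)
    have "filterlim (\<lambda>m. real m ^ (n - j)) at_top sequentially"
      using j by (intro filterlim_pow_at_top filterlim_real_sequentially) simp
    then have "(\<lambda>m. inverse (real m ^ (n - j))) \<longlonglongrightarrow> 0"
      by (rule tendsto_inverse_0_at_top)
    moreover have "\<forall>\<^sub>F m in sequentially. inverse (real m ^ (n - j)) = real m ^ j / real m ^ n"
      using eventually_gt_at_top [of 0]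
      by eventually_elim (use j in \<open>simp add: power_diff field_simps\<close>)
    ultimately show "(\<lambda>m. real m ^ j / real m ^ n) \<longlonglongrightarrow> 0"
      by (rule Lim_transform_eventually)
    show "\<forall>\<^sub>F m in sequentially. real m ^ n \<noteq> 0"
      using eventually_gt_at_top [of 0] by eventually_elim simp
  qed
  finally show "(\<lambda>m. 2 ^ j * real (m choose j)) \<in> o(\<lambda>m. real m ^ n)" .
qed

theorem theorem6p7:
  "\<exists>r :: nat \<Rightarrow> real.
     r \<in> o(\<lambda>m. real m ^ CARD('n::finite)) \<and>
     (\<forall>k d. \<forall>fs :: 'n trop_poly list.
        k \<ge> 1 \<longrightarrow> d \<ge> 1 \<longrightarrow>
        length fs = k \<longrightarrow>
        (\<forall>f\<in>set fs. tropical_polynomial f \<and> finite_coefficients f) \<longrightarrow>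
        Max (tropical_degree ` set fs) = d \<longrightarrow>
        compact (tropical_prevariety fs) \<longrightarrow>
        (let n = CARD('n); m = k * ((n + d) choose n)\<^sup>2
         in sum_betti_numbers (top_of_set (tropical_prevariety fs))
              \<le> ereal (3 ^ n + 2 ^ n * real (m choose n) + r m)))"
proof (intro exI conjI allI impI)
  let ?n = "CARD('n)"
  let ?r = "\<lambda>m. \<Sum>j<?n. 2 ^ j * real (m choose j)"
  show "?r \<in> o(\<lambda>m. real m ^ ?n)" by (rule face_bound_remainder_smallo)
  fix k d :: nat and fs :: "'n trop_poly list"
  assume "length fs = k"
    and trop: "\<forall>f\<in>set fs. tropical_polynomial f \<and> finite_coefficients f"
    and d: "Max (tropical_degree ` set fs) = d"
    and V: "compact (tropical_prevariety fs)"
  define m where "m = k * ((?n + d) choose ?n)\<^sup>2"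
  have "tropical_degree f \<le> d" if "f \<in> set fs" for f
    unfolding d [symmetric] using that by (intro Max_ge) auto
  then have "sum_betti_numbers (top_of_set (tropical_prevariety fs)) \<le> ereal (real (face_bound m ?n))"
    using sum_betti_numbers_tropical_prevariety_le [OF _ V, of d] trop \<open>length fs = k\<close> by (simp add: m_def)
  also have "real (face_bound m ?n) = 2 ^ ?n * real (m choose ?n) + ?r m"
    unfolding face_bound_def lessThan_Suc_atMost [symmetric] sum.lessThan_Suc by simp
  also have "ereal (2 ^ ?n * real (m choose ?n) + ?r m) \<le> ereal (3 ^ ?n + 2 ^ ?n * real (m choose ?n) + ?r m)"
    by simp
  finally show "let n = ?n; m = k * ((n + d) choose n)\<^sup>2
         in sum_betti_numbers (top_of_set (tropical_prevariety fs))
              \<le> ereal (3 ^ n + 2 ^ n * real (m choose n) + ?r m)"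
    by (simp add: Let_def m_def)
qed

end
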